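(* Let $\mathcal X\subseteq\mathbb R^m$, $\mathcal Y\subseteq\mathbb R^n$, and suppose that a Lipschitz-continuous function $f:\mathcal X\times\mathcal Y\to\mathbb R$ has Lipschitz-continuous gradient and Lipschitz-continuous Hessian and gives rise to a strictly $\alpha$-coherent saddle point (SP) problem. Let competitive gradient optimization (CGO) be run with perfect (exact) gradient and competitive Hessian oracles, with parameter $\alpha$ and a sequence of learning rates $\{\eta_n\}_{n\ge1}$, $\eta_n>0$, i.e. $z_{n+1}=z_n-\eta_n\,g_\alpha(z_n)$. If $\sum_{n=1}^\infty\eta_n^2<\infty$ and $\sum_{n=1}^\infty\eta_n=\infty$, then the sequence of iterates $\{z_n\}$ converges to a solution of the SP problem.
   Context: Write $z=(x,y)\in\mathcal X\times\mathcal Y$. For a parameter $\alpha$ the CGO gradient is $$g_\alpha(z)=\begin{bmatrix}I&\alpha\nabla_{xy}^2f(z)\\-\alpha\nabla_{yx}^2f(z)&I\end{bmatrix}^{-1}\begin{bmatrix}\nabla_xf(z)\\-\nabla_yf(z)\end{bmatrix},$$ where $\nabla_{xy}^2f$ is the $m\times n$ matrix of mixed second derivatives and $\nabla_{yx}^2f=(\nabla_{xy}^2f)^\top$. Lipschitz-continuous Hessian means that there are constants $L_{xx},L_{yy},L_{xy}$ such that for all $z_1,z_2\in\mathcal X\times\mathcal Y$: $\|\nabla_{xx}^2f(z_1)-\nabla_{xx}^2f(z_2)\|_2\le L_{xx}\|z_1-z_2\|_2$, $\|\nabla_{yy}^2f(z_1)-\nabla_{yy}^2f(z_2)\|_2\le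 L_{yy}\|z_1-z_2\|_2$, $\|\nabla_{xy}^2f(z_1)-\nabla_{xy}^2f(z_2)\|_2\le L_{xy}\|z_1-z_2\|_2$. Saddle points: a $\min$-$\max$ saddle point is a solution $(x^*,y^* )$ of $\min_{x\in\mathcal X}\max_{y\in\mathcal Y}f(x,y)$, in the sense $f(x^*,y)\le f(x^*,y^* )\le f(x,y^* )$ for all $x\in\mathcal X,y\in\mathcal Y$. A $\max$-$\min$ saddle point is a solution of $\max_{x\in\mathcal X}\min_{y\in\mathcal Y}f(x,y)$, defined with both inequalities reversed. $\alpha$-variational inequalities for a point $z^*=(x^*,y^* )$: - $\alpha$-MVI: $g_\alpha(z)^\top(z-z^* )\ge0$ for all $z\in\mathcal X\times\mathcal Y$. - $\alpha$-SVI: $g_\alpha(z^* )^\top(z-z^* )\ge0$ for all $z\in\mathcal X\times\mathcal Y$. The $\min$-$\max$ SP problem is $\alpha$-coherent if: (1) every solution $z^*$ of $\alpha$-SVI is a $\min$-$\max$ saddle point; (2) there exists a $\min$-$\max$ saddle point $p$ that satisfies $\alpha$-MVI (i.e. $\alpha$-MVI holds with $z^*=p$); (3) every $\min$-$\max$ saddle point $z^*$ satisfies $\alpha$-MVI locally, i.e. the inequality holds for all $z$ sufficiently close to $z^*$. The $\alpha$-coherent $\max$-$\min$ SP problem is defined similarly, with $\max$-$\min$ saddle points. The SP problem is strictly $\alpha$-coherent if it is $\alpha$-coherent and $\alpha$-MVI (for the point $p$ in (2)) holds as a strict inequality whenever $z$ is not a solution of the SP problem.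
   Formalization: The sets X and Y are additionally assumed closed; without this the claim is false (e.g. X = R minus {1}, where iterates can converge to the missing point 1). The iterates are taken to lie in X × Y, as needed for the run to be defined. *)

theory Defs
  imports "HOL-Analysis.Analysis"
begin

(* Second-order data of f on S. Derivatives are taken within S, so they involve the values of f
   on S only. Where the derivative within S is unique (e.g. S open, or convex with nonempty
   interior), G and the H's are the gradient and the Hessian blocks of f; elsewhere they are some
   choice of them. The (y,x)-block is the transpose of the (x,y)-block Hxy. *)

definition gradient_on ::
  "((real^'m) \<times> (real^'n) \<Rightarrow> real) \<Rightarrow> ((real^'m) \<times> (real^'n) \<Rightarrow> (real^'m) \<times> (real^'n))
    \<Rightarrow> ((real^'m) \<times> (real^'n)) set \<Rightarrow> bool" where
  "gradient_on f G S \<longleftrightarrow> (\<forall>z\<in>S. (f has_derivative (\<lambda>h. G z \<bullet> h)) (at z within S))"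

definition hessian_on ::
  "((real^'m) \<times> (real^'n) \<Rightarrow> (real^'m) \<times> (real^'n)) \<Rightarrow> ((real^'m) \<times> (real^'n) \<Rightarrow> real^'m^'m)
    \<Rightarrow> ((real^'m) \<times> (real^'n) \<Rightarrow> real^'n^'m) \<Rightarrow> ((real^'m) \<times> (real^'n) \<Rightarrow> real^'n^'n)
    \<Rightarrow> ((real^'m) \<times> (real^'n)) set \<Rightarrow> bool" where
  "hessian_on G Hxx Hxy Hyy S \<longleftrightarrow>
    (\<forall>z\<in>S. (G has_derivative
       (\<lambda>(h, k). (Hxx z *v h + Hxy z *v k, transpose (Hxy z) *v h + Hyy z *v k))) (at z within S))"

(* Spectral norm; the type-class norm on matrices is the Frobenius norm. *)

definition lipschitz_matrix_on ::
  "real \<Rightarrow> 'a::metric_space set \<Rightarrow> ('a \<Rightarrow> real^'k^'l) \<Rightarrow> bool" where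
  "lipschitz_matrix_on L S A \<longleftrightarrow>
    (\<forall>z1\<in>S. \<forall>z2\<in>S. onorm ((*v) (A z1 - A z2)) \<le> L * dist z1 z2)"

definition stack :: "(real^'m) \<times> (real^'n) \<Rightarrow> real^('m + 'n)" where
  "stack z = (\<chi> i. case i of Inl a \<Rightarrow> fst z $ a | Inr b \<Rightarrow> snd z $ b)"

definition unstack :: "real^('m + 'n) \<Rightarrow> (real^'m) \<times> (real^'n)" where
  "unstack v = (\<chi> a. v $ Inl a, \<chi> b. v $ Inr b)"

definition block_matrix ::
  "real^'m^'m \<Rightarrow> real^'n^'m \<Rightarrow> real^'m^'n \<Rightarrow> real^'n^'n \<Rightarrow> real^('m + 'n)^('m + 'n)" where
  "block_matrix A B C D = (\<chi> i j.
     case i of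
       Inl a \<Rightarrow> (case j of Inl c \<Rightarrow> A $ a $ c | Inr d \<Rightarrow> B $ a $ d)
     | Inr b \<Rightarrow> (case j of Inl c \<Rightarrow> C $ b $ c | Inr d \<Rightarrow> D $ b $ d))"

definition cgo_gradient ::
  "real \<Rightarrow> ((real^'m) \<times> (real^'n) \<Rightarrow> (real^'m) \<times> (real^'n)) \<Rightarrow> ((real^'m) \<times> (real^'n) \<Rightarrow> real^'n^'m)
    \<Rightarrow> (real^'m) \<times> (real^'n) \<Rightarrow> (real^'m) \<times> (real^'n)" where
  "cgo_gradient \<alpha> G Hxy z =
     unstack (matrix_inv (block_matrix (mat 1) (\<alpha> *\<^sub>R Hxy z) (- (\<alpha> *\<^sub>R transpose (Hxy z))) (mat 1))
       *v stack (fst (G z), - snd (G z)))"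

datatype sp_kind = MinMax | MaxMin

fun saddle_point ::
  "sp_kind \<Rightarrow> ('a \<times> 'b \<Rightarrow> real) \<Rightarrow> 'a set \<Rightarrow> 'b set \<Rightarrow> 'a \<times> 'b \<Rightarrow> bool" where
  "saddle_point MinMax f X Y (xs, ys) \<longleftrightarrow>
     xs \<in> X \<and> ys \<in> Y \<and> (\<forall>x\<in>X. \<forall>y\<in>Y. f (xs, y) \<le> f (xs, ys) \<and> f (xs, ys) \<le> f (x, ys))"
| "saddle_point MaxMin f X Y (xs, ys) \<longleftrightarrow>
     xs \<in> X \<and> ys \<in> Y \<and> (\<forall>x\<in>X. \<forall>y\<in>Y. f (xs, y) \<ge> f (xs, ys) \<and> f (xs, ys) \<ge> f (x, ys))"

(* The variational inequalities and coherence for a vector field g on X \<times> Y; the alpha-versions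
   are those for g = cgo_gradient alpha G Hxy. *)

definition MVI :: "('a::real_inner \<Rightarrow> 'a) \<Rightarrow> 'a set \<Rightarrow> 'a \<Rightarrow> bool" where
  "MVI g S zs \<longleftrightarrow> (\<forall>z\<in>S. g z \<bullet> (z - zs) \<ge> 0)"

definition SVI :: "('a::real_inner \<Rightarrow> 'a) \<Rightarrow> 'a set \<Rightarrow> 'a \<Rightarrow> bool" where
  "SVI g S zs \<longleftrightarrow> (\<forall>z\<in>S. g zs \<bullet> (z - zs) \<ge> 0)"

definition local_MVI :: "('a::real_inner \<Rightarrow> 'a) \<Rightarrow> 'a set \<Rightarrow> 'a \<Rightarrow> bool" where
  "local_MVI g S zs \<longleftrightarrow> (\<exists>\<epsilon>>0. \<forall>z\<in>S. dist z zs < \<epsilon> \<longrightarrow> g z \<bullet> (z - zs) \<ge> 0)"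

definition coherent ::
  "sp_kind \<Rightarrow> ('a::real_inner \<times> 'b::real_inner \<Rightarrow> real) \<Rightarrow> ('a \<times> 'b \<Rightarrow> 'a \<times> 'b)
    \<Rightarrow> 'a set \<Rightarrow> 'b set \<Rightarrow> bool" where
  "coherent \<kappa> f g X Y \<longleftrightarrow>
     (\<forall>zs\<in>X \<times> Y. SVI g (X \<times> Y) zs \<longrightarrow> saddle_point \<kappa> f X Y zs) \<and>
     (\<exists>p. saddle_point \<kappa> f X Y p \<and> MVI g (X \<times> Y) p) \<and>
     (\<forall>zs. saddle_point \<kappa> f X Y zs \<longrightarrow> local_MVI g (X \<times> Y) zs)"

definition strictly_coherent ::
  "sp_kind \<Rightarrow> ('a::real_inner \<times> 'b::real_inner \<Rightarrow> real) \<Rightarrow> ('a \<times> 'b \<Rightarrow> 'a \<times> 'b)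
    \<Rightarrow> 'a set \<Rightarrow> 'b set \<Rightarrow> bool" where
  "strictly_coherent \<kappa> f g X Y \<longleftrightarrow>
     coherent \<kappa> f g X Y \<and>
     (\<exists>p. saddle_point \<kappa> f X Y p \<and> MVI g (X \<times> Y) p \<and>
        (\<forall>z\<in>X \<times> Y. \<not> saddle_point \<kappa> f X Y z \<longrightarrow> g z \<bullet> (z - p) > 0))"

(* The step is not projected, so membership of the iterates in S (the domain of g) is part of
   the run being well defined. Indices start at 1. *)

definition cgo_run ::
  "('a::real_vector \<Rightarrow> 'a) \<Rightarrow> 'a set \<Rightarrow> (nat \<Rightarrow> real) \<Rightarrow> (nat \<Rightarrow> 'a) \<Rightarrow> bool" where
  "cgo_run g S \<eta> z \<longleftrightarrow> (\<forall>n\<ge>1. z n \<in> S \<and> z (Suc n) = z n - \<eta> n *\<^sub>R g (z n))"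

end

theory Submission
  imports Defs
begin

text \<open>
  The system matrix of the competitive gradient \<open>g\<close> is the identity plus a skew-symmetric matrix,
  so applying it does not decrease norms (\<open>norm_le_norm_cgo_map\<close>). Hence \<open>g\<close> is the unique
  solution of its linear system, is bounded in norm by \<open>G\<close>, which grows at most linearly, and
  inherits continuity from \<open>G\<close> and the mixed Hessian block.

  The rest is a quasi-Fejer argument. Let \<open>p\<close> be the saddle point that satisfies the variational
  inequality strictly away from the solutions. Expanding \<open>norm (z (n+1) - p)\<^sup>2\<close> and using
  linear growth together with the summability of the squared step sizes, a discrete Gronwall
  estimate (\<open>discrete_gronwall_bounded\<close>) bounds the iterates, and hence \<open>g\<close> along them. Summing
  the expansion then bounds the partial sums of \<open>\<eta> n * (g (z n) \<bullet> (z n - p))\<close>; since the step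
  sizes have a divergent sum, \<open>g (z n) \<bullet> (z n - p)\<close> comes arbitrarily close to zero
  (\<open>frequently_small_of_bounded_weighted_sum\<close>). By compactness and continuity the iterates have a
  cluster point \<open>q\<close> with \<open>g q \<bullet> (q - p) = 0\<close>, and strictness makes \<open>q\<close> a saddle point. The
  local variational inequality at \<open>q\<close> finally upgrades clustering to convergence
  (\<open>tendsto_of_local_MVI_cluster_point\<close>).
\<close>

section \<open>The competitive gradient as a vector field\<close>

lemma inner_matrix_transpose:
  fixes A :: "real^'n^'m"
  shows "(transpose A *v u) \<bullet> v = u \<bullet> (A *v v)"
  by (simp add: dot_lmul_matrix)

text \<open>The linear map of the block matrix with identity diagonal blocks and off-diagonal blocks \<open>A\<close> and
  minus its transpose, acting on pairs rather than on stacked vectors.\<close>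

definition cgo_map :: "real^'n^'m \<Rightarrow> (real^'m) \<times> (real^'n) \<Rightarrow> (real^'m) \<times> (real^'n)" where
  "cgo_map A w = (fst w + A *v snd w, snd w - transpose A *v fst w)"

lemma norm_le_norm_cgo_map: "norm w \<le> norm (cgo_map A w)"
proof -
  have "cgo_map A w \<bullet> w = w \<bullet> w"
    by (simp add: cgo_map_def inner_prod_def inner_add_left inner_diff_left
        inner_matrix_transpose inner_commute[of "A *v snd w"] del: transpose_matrix_vector)
  then have "norm w * norm w \<le> norm (cgo_map A w) * norm w"
    using norm_cauchy_schwarz[of "cgo_map A w" w]
    by (simp add: dot_square_norm power2_eq_square)
  then show ?thesis
    by (cases "w = 0") auto
qed

lemma cgo_map_diff: "cgo_map A (w - w') = cgo_map A w - cgo_map A w'"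
  by (simp add: cgo_map_def prod_eq_iff matrix_vector_mult_diff_distrib)

lemma stack_unstack [simp]: "stack (unstack v) = v"
  by (auto simp: stack_def unstack_def vec_eq_iff split: sum.split)

lemma unstack_stack [simp]: "unstack (stack z) = z"
  by (auto simp: stack_def unstack_def vec_eq_iff prod_eq_iff)

lemma sum_UNIV_Plus:
  "(\<Sum>j\<in>UNIV. h j) = (\<Sum>a\<in>UNIV. h (Inl a)) + (\<Sum>b\<in>UNIV. h (Inr b))"
  for h :: "'a::finite + 'b::finite \<Rightarrow> 'c::comm_monoid_add"
  using sum.Plus[of "UNIV :: 'a set" "UNIV :: 'b set" h] by (simp add: comp_def)

lemma block_matrix_mult_stack:
  fixes A :: "real^'n^'m"
  shows "block_matrix (mat 1) A (- transpose A) (mat 1) *v stack w = stack (cgo_map A w)"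
    (is "?v = _")
proof -
  have "?v $ i = stack (cgo_map A w) $ i" for i
  proof (cases i)
    case (Inl a)
    have "(\<Sum>c\<in>UNIV. mat 1 $ a $ c * fst w $ c) = (mat 1 *v fst w) $ a"
      by (simp only: matrix_vector_mult_def vec_lambda_beta)
    then show ?thesis
      by (simp add: Inl block_matrix_def stack_def cgo_map_def)
        (simp add: matrix_vector_mult_def sum_UNIV_Plus)
  next
    case (Inr b)
    have "(\<Sum>c\<in>UNIV. mat 1 $ b $ c * snd w $ c) = (mat 1 *v snd w) $ b"
      by (simp only: matrix_vector_mult_def vec_lambda_beta)
    then show ?thesis
      by (simp add: Inr block_matrix_def stack_def cgo_map_def del: transpose_matrix_vector)
        (simp add: matrix_vector_mult_def sum_UNIV_Plus sum_negf)
  qed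
  then show ?thesis
    by (simp add: vec_eq_iff)
qed

lemma invertible_block_matrix:
  "invertible (block_matrix (mat 1) A (- transpose A) (mat 1))" (is "invertible ?M")
proof -
  have "v = 0" if v: "?M *v v = 0" for v
  proof -
    have "stack (cgo_map A (unstack v)) = 0"
      using block_matrix_mult_stack[of A "unstack v"] v by simp
    then have "cgo_map A (unstack v) = unstack 0"
      by (metis unstack_stack)
    then have "cgo_map A (unstack v) = 0"
      by (simp add: unstack_def prod_eq_iff vec_eq_iff)
    then have "unstack v = 0"
      using norm_le_norm_cgo_map[of "unstack v" A] by simp
    then have "v = stack 0"
      by (metis stack_unstack)
    then show ?thesis
      by (auto simp: stack_def vec_eq_iff split: sum.split)
  qed
  then show ?thesis
    by (simp add: invertible_left_inverse matrix_left_invertible_ker)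
qed

text \<open>The competitive gradient solves its defining linear system.\<close>

lemma cgo_map_cgo_gradient:
  "cgo_map (\<alpha> *\<^sub>R Hxy z) (cgo_gradient \<alpha> G Hxy z) = (fst (G z), - snd (G z))"
proof -
  let ?A = "\<alpha> *\<^sub>R Hxy z"
  let ?M = "block_matrix (mat 1) ?A (- transpose ?A) (mat 1)"
  let ?b = "(fst (G z), - snd (G z))"
  have tr: "transpose ?A = \<alpha> *\<^sub>R transpose (Hxy z)"
    by (simp add: transpose_def vec_eq_iff)
  have inv: "?M ** matrix_inv ?M = mat 1"
    using invertible_block_matrix[of ?A] unfolding invertible_def matrix_inv_def
    by (rule someI2_ex) simp
  have "stack (cgo_map ?A (cgo_gradient \<alpha> G Hxy z)) = ?M *v stack (cgo_gradient \<alpha> G Hxy z)"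
    by (rule block_matrix_mult_stack[symmetric])
  also have "\<dots> = ?M *v (matrix_inv ?M *v stack ?b)"
    by (simp add: cgo_gradient_def tr)
  also have "\<dots> = stack ?b"
    by (simp add: matrix_vector_mul_assoc inv)
  finally show ?thesis
    by (metis unstack_stack)
qed

lemma norm_cgo_gradient_le: "norm (cgo_gradient \<alpha> G Hxy z) \<le> norm (G z)"
  using norm_le_norm_cgo_map[of "cgo_gradient \<alpha> G Hxy z" "\<alpha> *\<^sub>R Hxy z"]
  by (simp add: cgo_map_cgo_gradient norm_prod_def)

lemma lipschitz_matrix_on_imp_continuous_on:
  fixes A :: "'a::metric_space \<Rightarrow> real^'k^'l"
  assumes "lipschitz_matrix_on L S A"
  shows "continuous_on S A"
proof -
  have "continuous_on S (\<lambda>z. A z $ i $ j)" for i j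
  proof -
    have "\<bar>A z1 $ i $ j - A z2 $ i $ j\<bar> \<le> \<bar>L\<bar> * dist z1 z2" if "z1 \<in> S" "z2 \<in> S" for z1 z2
    proof -
      have "\<bar>A z1 $ i $ j - A z2 $ i $ j\<bar> \<le> onorm ((*v) (A z1 - A z2))"
        using matrix_component_le_onorm[of "A z1 - A z2" i j] by simp
      also have "\<dots> \<le> L * dist z1 z2"
        using assms that by (simp add: lipschitz_matrix_on_def)
      also have "\<dots> \<le> \<bar>L\<bar> * dist z1 z2"
        by (simp add: mult_right_mono)
      finally show ?thesis .
    qed
    then have "\<bar>L\<bar>-lipschitz_on S (\<lambda>z. A z $ i $ j)"
      by (auto intro!: lipschitz_onI simp: dist_real_def)
    then show ?thesis
      by (rule lipschitz_on_continuous_on)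
  qed
  then have "continuous_on S (\<lambda>z. \<chi> i. \<chi> j. A z $ i $ j)"
    by (intro continuous_on_vec_lambda)
  then show ?thesis
    by simp
qed

lemma continuous_on_cgo_gradient:
  assumes G: "continuous_on S G" and H: "continuous_on S Hxy"
  shows "continuous_on S (cgo_gradient \<alpha> G Hxy)"
proof (unfold continuous_on_def, intro ballI)
  fix q assume q: "q \<in> S"
  let ?g = "cgo_gradient \<alpha> G Hxy"
  let ?T = "\<lambda>z. cgo_map (\<alpha> *\<^sub>R Hxy z)"
  let ?b = "\<lambda>z. (fst (G z), - snd (G z))"
  have tr: "continuous_on S (\<lambda>z. transpose (\<alpha> *\<^sub>R Hxy z))"
    unfolding transpose_def by (intro continuous_intros H)
  have "continuous_on S (\<lambda>z. ?b z - ?T z (?g q))"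
    unfolding cgo_map_def matrix_vector_mult_def
    by (intro continuous_intros G H tr)
  then have "((\<lambda>z. ?b z - ?T z (?g q)) \<longlongrightarrow> ?b q - ?T q (?g q)) (at q within S)"
    using q by (simp only: continuous_on_def)
  then have lim: "((\<lambda>z. norm (?b z - ?T z (?g q))) \<longlongrightarrow> 0) (at q within S)"
    using tendsto_norm_zero by (fastforce simp: cgo_map_cgo_gradient)
  \<comment> \<open>The system matrix is expanding, so the residual of the fixed vector bounds the increment.\<close>
  have "norm (?g z - ?g q) \<le> norm (?b z - ?T z (?g q))" for z
    using norm_le_norm_cgo_map[of "?g z - ?g q" "\<alpha> *\<^sub>R Hxy z"]
    by (simp add: cgo_map_diff cgo_map_cgo_gradient)
  then have "((\<lambda>z. ?g z - ?g q) \<longlongrightarrow> 0) (at q within S)"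
    by (intro Lim_null_comparison[OF _ lim]) simp
  then show "(?g \<longlongrightarrow> ?g q) (at q within S)"
    by (rule Lim_transform[OF tendsto_const, THEN iffD1[OF filterlim_cong[OF refl refl], rotated]]) simp
qed

section \<open>Convergence of unprojected descent\<close>

lemma descent_step:
  fixes g :: "'a::real_inner \<Rightarrow> 'a"
  shows "(norm (x - e *\<^sub>R g x - q))\<^sup>2
    = (norm (x - q))\<^sup>2 - 2 * e * (g x \<bullet> (x - q)) + e\<^sup>2 * (norm (g x))\<^sup>2"
  using dot_norm_neg[of "x - q" "e *\<^sub>R g x"]
  by (simp add: inner_commute field_simps)

lemma discrete_gronwall_bounded:
  fixes u s :: "nat \<Rightarrow> real"
  assumes step: "\<And>n. u (Suc n) \<le> (1 + s n) * u n"
    and u: "\<And>n. u n \<ge> 0" and s: "\<And>n. s n \<ge> 0" and summ: "summable s"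
  shows "u n \<le> exp (suminf s) * u 0"
proof -
  have "u n \<le> exp (sum s {..<n}) * u 0"
  proof (induction n)
    case (Suc n)
    have "u (Suc n) \<le> (1 + s n) * u n"
      by (rule step)
    also have "\<dots> \<le> exp (s n) * (exp (sum s {..<n}) * u 0)"
      by (intro mult_mono Suc exp_ge_add_one_self u) auto
    finally show ?case
      by (simp add: exp_add algebra_simps)
  qed simp
  also have "\<dots> \<le> exp (suminf s) * u 0"
    by (intro mult_right_mono u) (simp add: sum_le_suminf summ s)
  finally show ?thesis .
qed

text \<open>If the weights have a divergent sum, weighted partial sums can only stay bounded
  when the summands come arbitrarily close to zero.\<close>

lemma frequently_small_of_bounded_weighted_sum:
  fixes e a :: "nat \<Rightarrow> real"
  assumes e: "\<And>n. e n > 0" and a: "\<And>n. a n \<ge> 0"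
    and bdd: "\<And>n. (\<Sum>k<n. e k * a k) \<le> C"
    and div: "filterlim (\<lambda>n. \<Sum>k<n. e k) at_top sequentially"
    and \<delta>: "\<delta> > 0"
  shows "\<exists>n\<ge>N. a n < \<delta>"
proof (rule ccontr)
  assume "\<not> ?thesis"
  then have ge: "a n \<ge> \<delta>" if "n \<ge> N" for n
    using that by force
  have "\<delta> * ((\<Sum>k<n. e k) - (\<Sum>k<N. e k)) \<le> C" for n
  proof -
    have "\<delta> * (\<Sum>k<n. e k) \<le> (\<Sum>k<n. e k * a k + (if k < N then \<delta> * e k else 0))"
      unfolding sum_distrib_left
    proof (rule sum_mono)
      fix k
      show "\<delta> * e k \<le> e k * a k + (if k < N then \<delta> * e k else 0)"
        using e[of k] a[of k] ge[of k] by (auto simp: mult.commute)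
    qed
    also have "\<dots> = (\<Sum>k<n. e k * a k) + (\<Sum>k\<in>{..<n} \<inter> {k. k < N}. \<delta> * e k)"
      by (simp add: sum.distrib sum.inter_restrict)
    also have "(\<Sum>k\<in>{..<n} \<inter> {k. k < N}. \<delta> * e k) \<le> (\<Sum>k<N. \<delta> * e k)"
      using e \<delta> by (intro sum_mono2) (auto intro: less_imp_le)
    finally show ?thesis
      using bdd[of n] by (simp add: sum_distrib_left algebra_simps)
  qed
  then have "(\<Sum>k<n. e k) \<le> C / \<delta> + (\<Sum>k<N. e k)" for n
    using \<delta> by (simp add: field_simps)
  moreover have "\<exists>n. (\<Sum>k<n. e k) \<ge> C / \<delta> + (\<Sum>k<N. e k) + 1"
    using div unfolding filterlim_at_top
    by (meson eventually_happens sequentially_bot)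
  ultimately show False
    by (smt (verit))
qed

text \<open>When the field is bounded along the iterates, squared distances to a point satisfying the variational
  inequality locally grow by at most a summable amount for as long as the iterates stay near it,
  so an iterate that comes close at a late time traps all later ones.\<close>

lemma tendsto_of_local_MVI_cluster_point:
  fixes g :: "'a::real_inner \<Rightarrow> 'a"
  assumes w: "\<And>n. w n \<in> S" and step: "\<And>n. w (Suc n) = w n - e n *\<^sub>R g (w n)"
    and e: "\<And>n. e n > 0" and summ: "summable (\<lambda>n. (e n)\<^sup>2)"
    and B: "\<And>n. norm (g (w n)) \<le> B"
    and loc: "local_MVI g S q"
    and cluster: "\<And>N \<delta>. \<delta> > 0 \<Longrightarrow> \<exists>n\<ge>N. dist (w n) q < \<delta>"
  shows "w \<longlonglongrightarrow> q"
proof -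
  obtain \<epsilon>0 where \<epsilon>0: "\<epsilon>0 > 0" "\<And>x. x \<in> S \<Longrightarrow> dist x q < \<epsilon>0 \<Longrightarrow> g x \<bullet> (x - q) \<ge> 0"
    using loc unfolding local_MVI_def by blast
  have sB: "summable (\<lambda>n. B\<^sup>2 * (e n)\<^sup>2)"
    using summ by (rule summable_mult)
  show ?thesis
  proof (rule metric_LIMSEQ_I)
    fix \<epsilon>' :: real assume \<epsilon>': "\<epsilon>' > 0"
    define \<epsilon> where "\<epsilon> = min \<epsilon>' \<epsilon>0"
    have \<epsilon>: "\<epsilon> > 0" "\<epsilon> \<le> \<epsilon>'" "\<epsilon> \<le> \<epsilon>0"
      using \<epsilon>' \<epsilon>0 by (auto simp: \<epsilon>_def)
    obtain N where N: "\<And>m n. m \<ge> N \<Longrightarrow> norm (\<Sum>k=m..<n. B\<^sup>2 * (e k)\<^sup>2) < \<epsilon>\<^sup>2 / 2"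
      using sB \<epsilon> unfolding summable_Cauchy by (meson half_gt_zero zero_less_power)
    obtain m where "m \<ge> N" "dist (w m) q < sqrt (\<epsilon>\<^sup>2 / 2)"
      using cluster[of "sqrt (\<epsilon>\<^sup>2 / 2)" N] \<epsilon>(1) by auto
    then have m: "m \<ge> N" "(norm (w m - q))\<^sup>2 < \<epsilon>\<^sup>2 / 2"
      by (metis, metis dist_norm norm_ge_zero real_sqrt_abs real_sqrt_less_iff abs_of_nonneg)
    have near: "norm (w n - q) < \<epsilon>"
      if "(norm (w n - q))\<^sup>2 \<le> (norm (w m - q))\<^sup>2 + (\<Sum>k=m..<n. B\<^sup>2 * (e k)\<^sup>2)" for n
    proof -
      have "(norm (w n - q))\<^sup>2 < \<epsilon>\<^sup>2"
        using that m N[of m n] by simp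
      then show ?thesis
        using \<epsilon>(1) by (simp add: power2_less_imp_less)
    qed
    have "(norm (w n - q))\<^sup>2 \<le> (norm (w m - q))\<^sup>2 + (\<Sum>k=m..<n. B\<^sup>2 * (e k)\<^sup>2)" if "n \<ge> m" for n
      using that
    proof (induction n rule: dec_induct)
      case (step n)
      have "g (w n) \<bullet> (w n - q) \<ge> 0"
        using near[OF step.IH] \<epsilon> w by (intro \<epsilon>0) (auto simp: dist_norm)
      then have "0 \<le> 2 * e n * (g (w n) \<bullet> (w n - q))"
        using e[of n] by simp
      moreover have "(e n)\<^sup>2 * (norm (g (w n)))\<^sup>2 \<le> (e n)\<^sup>2 * B\<^sup>2"
        using B[of n] by (intro mult_left_mono power_mono) auto
      ultimately show ?case
        using step descent_step[of "w n" "e n" g q]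
        by (simp add: assms(2) mult.commute)
    qed simp
    then show "\<exists>no. \<forall>n\<ge>no. dist (w n) q < \<epsilon>'"
      using near \<epsilon> by (force simp: dist_norm intro!: exI[of _ m])
  qed
qed

text \<open>Linear growth of the field, rather than boundedness, suffices: it makes the squared
  distance to the reference point grow at most by summable factors.\<close>

lemma descent_converges:
  fixes g :: "'a::euclidean_space \<Rightarrow> 'a"
  assumes S: "closed S" and cont: "continuous_on S g"
    and growth: "\<And>x. x \<in> S \<Longrightarrow> norm (g x) \<le> C + K * norm (x - p)"
    and mvi: "MVI g S p"
    and loc: "\<And>q. q \<in> S \<Longrightarrow> g q \<bullet> (q - p) = 0 \<Longrightarrow> local_MVI g S q"
    and w: "\<And>n. w n \<in> S" and step: "\<And>n. w (Suc n) = w n - e n *\<^sub>R g (w n)"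
    and e: "\<And>n. e n > 0" and summ: "summable (\<lambda>n. (e n)\<^sup>2)"
    and div: "filterlim (\<lambda>n. \<Sum>k<n. e k) at_top sequentially"
  shows "\<exists>q\<in>S. g q \<bullet> (q - p) = 0 \<and> w \<longlonglongrightarrow> q"
proof -
  define d where "d n = (norm (w n - p))\<^sup>2" for n
  define a where "a n = g (w n) \<bullet> (w n - p)" for n
  define c where "c = 2 * C\<^sup>2 + 2 * K\<^sup>2"
  have a: "a n \<ge> 0" for n
    using mvi w by (auto simp: a_def MVI_def)
  have d: "d (Suc n) = d n - 2 * e n * a n + (e n)\<^sup>2 * (norm (g (w n)))\<^sup>2" for n
    by (simp add: d_def a_def step descent_step)
  have g2: "(norm (g (w n)))\<^sup>2 \<le> c * (d n + 1)" for n
  proof -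
    have "(norm (g (w n)))\<^sup>2 \<le> (C + K * norm (w n - p))\<^sup>2"
      using growth[OF w] by (intro power_mono) auto
    also have "\<dots> \<le> 2 * C\<^sup>2 + 2 * (K * norm (w n - p))\<^sup>2"
      using zero_le_power2[of "C - K * norm (w n - p)"]
      by (simp add: power2_sum power2_diff)
    also have "\<dots> \<le> c * (d n + 1)"
      by (simp add: c_def d_def power_mult_distrib algebra_simps)
    finally show ?thesis .
  qed
  have c: "c \<ge> 0" by (simp add: c_def)
  define D where "D = exp (\<Sum>n. c * (e n)\<^sup>2) * (d 0 + 1)"
  have dD: "d n + 1 \<le> D" for n
    unfolding D_def
  proof (rule discrete_gronwall_bounded[where u = "\<lambda>n. d n + 1"])
    fix n
    have "0 \<le> 2 * e n * a n"
      using e[of n] a[of n] by simp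
    moreover have "(e n)\<^sup>2 * (norm (g (w n)))\<^sup>2 \<le> (e n)\<^sup>2 * (c * (d n + 1))"
      using g2 by (rule mult_left_mono) simp
    ultimately show "d (Suc n) + 1 \<le> (1 + c * (e n)\<^sup>2) * (d n + 1)"
      unfolding d by (simp add: algebra_simps)
  qed (use c summ in \<open>auto simp: d_def intro: summable_mult\<close>)
  have g2D: "(norm (g (w n)))\<^sup>2 \<le> c * D" for n
    using g2[of n] mult_left_mono[OF dD[of n] c] by linarith
  have gB: "norm (g (w n)) \<le> sqrt (c * D)" for n
    using g2D real_le_rsqrt by blast
  have "bounded (range w)"
  proof (rule boundedI)
    fix x assume "x \<in> range w"
    then obtain n where x: "x = w n" by blast
    have "(norm (w n - p))\<^sup>2 \<le> D"
      using dD[of n] by (simp add: d_def)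
    then have "norm (w n - p) \<le> sqrt D"
      by (rule real_le_rsqrt)
    then show "norm x \<le> norm p + sqrt D"
      using norm_triangle_sub[of "w n" p] unfolding x by linarith
  qed
  have part: "d n + 2 * (\<Sum>k<n. e k * a k) \<le> d 0 + c * D * (\<Sum>k<n. (e k)\<^sup>2)" for n
  proof (induction n)
    case (Suc n)
    have "(e n)\<^sup>2 * (norm (g (w n)))\<^sup>2 \<le> (e n)\<^sup>2 * (c * D)"
      using g2D by (rule mult_left_mono) simp
    then show ?case
      using Suc d[of n] by (simp add: algebra_simps)
  qed simp
  have cD: "c * D \<ge> 0"
    using g2D[of 0] by (meson order_trans zero_le_power2)
  have bdd: "(\<Sum>k<n. e k * a k) \<le> (d 0 + c * D * (\<Sum>k. (e k)\<^sup>2)) / 2" for n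
  proof -
    have "c * D * (\<Sum>k<n. (e k)\<^sup>2) \<le> c * D * (\<Sum>k. (e k)\<^sup>2)"
      by (intro mult_left_mono cD sum_le_suminf summ) auto
    moreover have "d n \<ge> 0"
      by (simp add: d_def)
    ultimately show ?thesis
      using part[of n] by simp
  qed
  have "\<exists>n\<ge>N. a n < inverse (real (Suc N))" for N
    by (rule frequently_small_of_bounded_weighted_sum[OF e a bdd div]) simp
  then obtain t where t: "\<And>N. t N \<ge> N" "\<And>N. a (t N) < inverse (real (Suc N))"
    by metis
  have at: "(\<lambda>N. a (t N)) \<longlonglongrightarrow> 0"
    by (rule tendsto_sandwich[OF _ _ tendsto_const LIMSEQ_inverse_real_of_nat])
      (use a t in \<open>auto intro!: always_eventually simp: less_imp_le simp del: of_nat_Suc\<close>)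
  have "bounded (range (w \<circ> t))"
    using \<open>bounded (range w)\<close> by (rule bounded_subset) auto
  then obtain q r where r: "strict_mono r" "((w \<circ> t) \<circ> r) \<longlonglongrightarrow> q"
    using bounded_imp_convergent_subsequence by blast
  have q: "q \<in> S"
    by (rule closed_sequentially[OF S _ r(2)]) (use w in auto)
  have "(\<lambda>k. g (((w \<circ> t) \<circ> r) k)) \<longlonglongrightarrow> g q"
    by (rule continuous_on_tendsto_compose[OF cont r(2) q]) (use w in auto)
  then have "(\<lambda>k. g (((w \<circ> t) \<circ> r) k) \<bullet> (((w \<circ> t) \<circ> r) k - p)) \<longlonglongrightarrow> g q \<bullet> (q - p)"
    by (intro tendsto_intros r)
  moreover have "(\<lambda>k. g (((w \<circ> t) \<circ> r) k) \<bullet> (((w \<circ> t) \<circ> r) k - p)) \<longlonglongrightarrow> 0"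
    using LIMSEQ_subseq_LIMSEQ[OF at r(1)] by (simp add: a_def comp_def)
  ultimately have q0: "g q \<bullet> (q - p) = 0"
    by (rule LIMSEQ_unique)
  have cluster: "\<exists>n\<ge>N. dist (w n) q < \<delta>" if \<delta>: "\<delta> > 0" for N \<delta>
  proof -
    obtain M where M: "\<And>k. k \<ge> M \<Longrightarrow> dist (((w \<circ> t) \<circ> r) k) q < \<delta>"
      using metric_LIMSEQ_D[OF r(2) \<delta>] by blast
    have "t (r (max M N)) \<ge> N"
      using t(1)[of "r (max M N)"] seq_suble[OF r(1), of "max M N"] by linarith
    then show ?thesis
      using M[of "max M N"] by auto
  qed
  have "w \<longlonglongrightarrow> q"
    by (rule tendsto_of_local_MVI_cluster_point[OF w step e summ gB loc[OF q q0] cluster])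
  then show ?thesis
    using q q0 by blast
qed

section \<open>Convergence of competitive gradient optimization\<close>

theorem theorem3:
  fixes X :: "(real^'m) set" and Y :: "(real^'n) set"
    and f :: "(real^'m) \<times> (real^'n) \<Rightarrow> real"
    and G :: "(real^'m) \<times> (real^'n) \<Rightarrow> (real^'m) \<times> (real^'n)"
    and Hxx :: "(real^'m) \<times> (real^'n) \<Rightarrow> real^'m^'m"
    and Hxy :: "(real^'m) \<times> (real^'n) \<Rightarrow> real^'n^'m"
    and Hyy :: "(real^'m) \<times> (real^'n) \<Rightarrow> real^'n^'n"
    and Lf LG Lxx Lxy Lyy \<alpha> :: real
    and \<kappa> :: sp_kind
    and \<eta> :: "nat \<Rightarrow> real"
    and z :: "nat \<Rightarrow> (real^'m) \<times> (real^'n)"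
  assumes "closed X" and "closed Y"
    and "gradient_on f G (X \<times> Y)"
    and "hessian_on G Hxx Hxy Hyy (X \<times> Y)"
    and "Lf-lipschitz_on (X \<times> Y) f"
    and "LG-lipschitz_on (X \<times> Y) G"
    and "lipschitz_matrix_on Lxx (X \<times> Y) Hxx"
    and "lipschitz_matrix_on Lyy (X \<times> Y) Hyy"
    and "lipschitz_matrix_on Lxy (X \<times> Y) Hxy"
    and "strictly_coherent \<kappa> f (cgo_gradient \<alpha> G Hxy) X Y"
    and "\<And>n. n \<ge> 1 \<Longrightarrow> \<eta> n > 0"
    and "cgo_run (cgo_gradient \<alpha> G Hxy) (X \<times> Y) \<eta> z"
    and "summable (\<lambda>n. (\<eta> (Suc n))\<^sup>2)"
    and "filterlim (\<lambda>N. \<Sum>n = 1..N. \<eta> n) at_top sequentially"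
  shows "\<exists>zs. saddle_point \<kappa> f X Y zs \<and> z \<longlonglongrightarrow> zs"
proof -
  let ?g = "cgo_gradient \<alpha> G Hxy"
  let ?S = "X \<times> Y"
  have lipG: "LG-lipschitz_on ?S G" by fact
  obtain p where p: "saddle_point \<kappa> f X Y p" "MVI ?g ?S p"
      "\<And>q. q \<in> ?S \<Longrightarrow> \<not> saddle_point \<kappa> f X Y q \<Longrightarrow> ?g q \<bullet> (q - p) > 0"
    using \<open>strictly_coherent \<kappa> f ?g X Y\<close> unfolding strictly_coherent_def by blast
  have loc: "local_MVI ?g ?S q" if "saddle_point \<kappa> f X Y q" for q
    using \<open>strictly_coherent \<kappa> f ?g X Y\<close> that unfolding strictly_coherent_def coherent_def by blast
  have pS: "p \<in> ?S"
    using p(1) by (cases \<kappa>; cases p) auto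
  have sp: "saddle_point \<kappa> f X Y q" if "q \<in> ?S" "?g q \<bullet> (q - p) = 0" for q
    using p(3)[OF that(1)] that(2) by force
  have run: "z (Suc n) \<in> ?S" "z (Suc (Suc n)) = z (Suc n) - \<eta> (Suc n) *\<^sub>R ?g (z (Suc n))" for n
    using \<open>cgo_run ?g ?S \<eta> z\<close> by (auto simp: cgo_run_def)
  have "\<exists>q\<in>?S. ?g q \<bullet> (q - p) = 0 \<and> (\<lambda>n. z (Suc n)) \<longlonglongrightarrow> q"
  proof (rule descent_converges[where e = "\<lambda>n. \<eta> (Suc n)" and C = "norm (G p)" and K = LG])
    show "closed ?S"
      using assms by (intro closed_Times)
    show "continuous_on ?S ?g"
      using assms by (intro continuous_on_cgo_gradient lipschitz_matrix_on_imp_continuous_on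
          lipschitz_on_continuous_on)
    show "norm (?g x) \<le> norm (G p) + LG * norm (x - p)" if "x \<in> ?S" for x
    proof -
      have "norm (G x - G p) \<le> LG * norm (x - p)"
        using lipschitz_onD[OF lipG that pS] by (simp add: dist_norm)
      then show ?thesis
        using norm_cgo_gradient_le[of \<alpha> G Hxy x] norm_triangle_sub[of "G x" "G p"] by linarith
    qed
    have "(\<Sum>n = 1..N. \<eta> n) = (\<Sum>n<N. \<eta> (Suc n))" for N
      by (simp add: sum.atLeast1_atMost_eq)
    then show "filterlim (\<lambda>N. \<Sum>n<N. \<eta> (Suc n)) at_top sequentially"
      using assms by simp
  qed (use p loc sp run assms in auto)
  then show ?thesis
    using sp filterlim_sequentially_Suc[of z] by blast
qed

end
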